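(* Let $X$ be a real normed linear space, $\Omega\subseteq X$ a nonempty closed set, $v\in X$ nonzero, and $T(x):=\inf\{t\ge 0\mid x+tv\in\Omega\}$. For any $\bar x\in\Omega$, $$\partial^-T(\bar x)=\{x^*\in X^*\mid\langle x^*,-v\rangle\le 1\}\cap N^-(\bar x;\Omega).$$
   Context: $T$ takes values in $[0,\infty]$ with $\inf\emptyset=\infty$; $X^*$ is the topological dual of $X$. For $\psi:X\to(-\infty,\infty]$ and $\bar x$ with $\psi(\bar x)<\infty$, the Dini-Hadamard directional derivative in direction $u$ is $\psi'(\bar x;u):=\liminf_{t\to0^+,\,w\to u}\frac{\psi(\bar x+tw)-\psi(\bar x)}{t}$, and the Dini-Hadamard subdifferential is $\partial^-\psi(\bar x):=\{x^*\in X^*\mid\langle x^*,h\rangle\le\psi'(\bar x;h)\ \forall h\in X\}$. For $\bar x\in\Omega$, the Bouligand contingent cone $K(\bar x;\Omega)$ is the set of $d\in X$ such that there exist sequences $t_k\to0^+$ (with $t_k>0$) and $d_k\to d$ with $\bar x+t_kd_k\in\Omega$ for every $k$, and the Dini-Hadamard normal cone is $N^-(\bar x;\Omega):=\{x^*\in X^*\mid\langle x^*,d\rangle\le0\ \forall d\in K(\bar x;\Omega)\}$. *)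

theory Defs
  imports "HOL-Analysis.Analysis"
begin

(* The infimum is taken in ereal, so it is \<infinity> when no admissible t exists. *)
definition minimal_time :: "'a::real_normed_vector set \<Rightarrow> 'a \<Rightarrow> 'a \<Rightarrow> ereal" where
  "minimal_time \<Omega> v x = Inf {ereal t | t. 0 \<le> t \<and> x + t *\<^sub>R v \<in> \<Omega>}"

(* Meant for \<psi> with values in (-\<infinity>, \<infinity>] and a point x with \<psi> x finite. The lower limit is
   joint in t \<rightarrow> 0+ and w \<rightarrow> u, and w = u is allowed (nhds u, not at u). *)
definition dini_hadamard_deriv ::
    "('a::real_normed_vector \<Rightarrow> ereal) \<Rightarrow> 'a \<Rightarrow> 'a \<Rightarrow> ereal" where
  "dini_hadamard_deriv \<psi> x u =
     Liminf (at_right (0::real) \<times>\<^sub>F nhds u) (\<lambda>(t, w). (\<psi> (x + t *\<^sub>R w) - \<psi> x) / ereal t)"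

definition dini_hadamard_subdiff ::
    "('a::real_normed_vector \<Rightarrow> ereal) \<Rightarrow> 'a \<Rightarrow> ('a \<Rightarrow>\<^sub>L real) set" where
  "dini_hadamard_subdiff \<psi> x =
     {f. \<forall>h. ereal (blinfun_apply f h) \<le> dini_hadamard_deriv \<psi> x h}"

definition contingent_cone :: "'a::real_normed_vector \<Rightarrow> 'a set \<Rightarrow> 'a set" where
  "contingent_cone x \<Omega> =
     {d. \<exists>(t :: nat \<Rightarrow> real) (e :: nat \<Rightarrow> 'a).
           (\<forall>k. 0 < t k) \<and> t \<longlonglongrightarrow> 0 \<and> e \<longlonglongrightarrow> d \<and> (\<forall>k. x + t k *\<^sub>R e k \<in> \<Omega>)}"

definition dini_hadamard_normal_cone ::
    "'a::real_normed_vector \<Rightarrow> 'a set \<Rightarrow> ('a \<Rightarrow>\<^sub>L real) set" where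
  "dini_hadamard_normal_cone x \<Omega> =
     {f. \<forall>d \<in> contingent_cone x \<Omega>. blinfun_apply f d \<le> 0}"

end

theory Submission
  imports Defs
begin

text \<open>
  Testing the Dini-Hadamard derivative along the constant direction \<open>-v\<close> and along the sequences
  that define the contingent cone gives one inclusion. Conversely, if
  \<open>T (x + t\<^sub>k w\<^sub>k) < c t\<^sub>k\<close> with \<open>w\<^sub>k \<longrightarrow> h\<close>, then
  \<open>x + t\<^sub>k (w\<^sub>k + r\<^sub>k v) \<in> \<Omega>\<close> for some \<open>r\<^sub>k \<in> [0, c)\<close>; a limit point \<open>r\<close> of \<open>r\<^sub>k\<close>
  makes \<open>h + r v\<close> a contingent direction, so that \<open>f h \<le> r f (-v) \<le> r \<le> c\<close>.
\<close>

lemma minimal_time_nonneg: "0 \<le> minimal_time \<Omega> v y"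
  unfolding minimal_time_def by (auto intro: Inf_greatest)

lemma minimal_time_le:
  assumes "0 \<le> s" "y + s *\<^sub>R v \<in> \<Omega>"
  shows "minimal_time \<Omega> v y \<le> ereal s"
  unfolding minimal_time_def using assms by (auto intro: Inf_lower)

lemma minimal_time_eq_0:
  assumes "y \<in> \<Omega>"
  shows "minimal_time \<Omega> v y = 0"
  using minimal_time_le[of 0 y v \<Omega>] minimal_time_nonneg[of \<Omega> v y] assms
  by (simp add: zero_ereal_def[symmetric] antisym)

text \<open>Any element of the set below \<open>c\<close> serves as \<open>s\<close>, whether or not
  the infimum is attained.\<close>

lemma minimal_time_lessD:
  assumes "minimal_time \<Omega> v y < ereal c"
  obtains s where "0 \<le> s" "s < c" "y + s *\<^sub>R v \<in> \<Omega>"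
  using assms unfolding minimal_time_def Inf_less_iff by auto

text \<open>If the lower limit exceeded \<open>c\<close>, then so would the quotient, eventually
  along the product filter and hence at some (\<open>t k\<close>, \<open>w k\<close>). This lets the
  derivative be tested on any convenient pair of sequences.\<close>

lemma dini_hadamard_deriv_le:
  fixes t :: "nat \<Rightarrow> real"
  assumes "\<And>k. 0 < t k" "t \<longlonglongrightarrow> 0" "w \<longlonglongrightarrow> u"
    and le: "\<And>k. (\<psi> (x + t k *\<^sub>R w k) - \<psi> x) / ereal (t k) \<le> c"
  shows "dini_hadamard_deriv \<psi> x u \<le> c"
proof (rule ccontr)
  assume "\<not> ?thesis"
  then have "c < Liminf (at_right 0 \<times>\<^sub>F nhds u) (\<lambda>(t, w). (\<psi> (x + t *\<^sub>R w) - \<psi> x) / ereal t)"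
    unfolding dini_hadamard_deriv_def by simp
  then have ev: "\<forall>\<^sub>F p in at_right 0 \<times>\<^sub>F nhds u.
      c < (case p of (t, w) \<Rightarrow> (\<psi> (x + t *\<^sub>R w) - \<psi> x) / ereal t)"
    by (rule less_LiminfD)
  have "filterlim t (at_right 0) sequentially"
    using assms(1,2) by (auto intro!: tendsto_imp_filterlim_at_right always_eventually)
  then have "filterlim (\<lambda>k. (t k, w k)) (at_right 0 \<times>\<^sub>F nhds u) sequentially"
    using assms(3) by (rule filterlim_Pair)
  then have "\<forall>\<^sub>F k in sequentially. c < (\<psi> (x + t k *\<^sub>R w k) - \<psi> x) / ereal (t k)"
    using eventually_compose_filterlim[OF ev] by fastforce
  then obtain k where "c < (\<psi> (x + t k *\<^sub>R w k) - \<psi> x) / ereal (t k)"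
    by (auto dest: eventually_happens)
  with le[of k] show False by simp
qed

text \<open>Passage from the filter back to sequences: if all pairs within 1/(k+1) of (0,
  \<open>u\<close>) with positive time had quotient at least \<open>c\<close>, the lower limit would
  be at least \<open>c\<close>. One exceptional pair is chosen for each k.\<close>

lemma dini_hadamard_deriv_lessD:
  assumes "dini_hadamard_deriv \<psi> x u < c"
  obtains t :: "nat \<Rightarrow> real" and w where "\<And>k. 0 < t k" "t \<longlonglongrightarrow> 0" "w \<longlonglongrightarrow> u"
    "\<And>k. (\<psi> (x + t k *\<^sub>R w k) - \<psi> x) / ereal (t k) < c"
proof -
  have "\<exists>t w. 0 < t \<and> t < inverse (real (Suc k)) \<and> dist w u < inverse (real (Suc k)) \<and>
          (\<psi> (x + t *\<^sub>R w) - \<psi> x) / ereal t < c" for k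
  proof (rule ccontr)
    assume "\<not> ?thesis"
    then have ge: "c \<le> (\<psi> (x + t *\<^sub>R w) - \<psi> x) / ereal t"
      if "0 < t" "t < inverse (real (Suc k))" "dist w u < inverse (real (Suc k))" for t w
      using that by (auto simp del: of_nat_Suc simp flip: not_less)
    have "\<forall>\<^sub>F t in at_right 0. 0 < t \<and> t < inverse (real (Suc k))"
      by (rule eventually_at_rightI[of _ "inverse (real (Suc k))"]) auto
    moreover have "\<forall>\<^sub>F w in nhds u. dist w u < inverse (real (Suc k))"
      unfolding eventually_nhds_metric by (intro exI[of _ "inverse (real (Suc k))"]) auto
    ultimately have "\<forall>\<^sub>F p in at_right 0 \<times>\<^sub>F nhds u.
        (0 < fst p \<and> fst p < inverse (real (Suc k))) \<and> dist (snd p) u < inverse (real (Suc k))"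
      by (rule eventually_prodI)
    then have "\<forall>\<^sub>F p in at_right 0 \<times>\<^sub>F nhds u.
        c \<le> (case p of (t, w) \<Rightarrow> (\<psi> (x + t *\<^sub>R w) - \<psi> x) / ereal t)"
      by (rule eventually_mono) (use ge in \<open>simp add: case_prod_beta del: of_nat_Suc\<close>)
    then have "c \<le> dini_hadamard_deriv \<psi> x u"
      unfolding dini_hadamard_deriv_def by (rule Liminf_bounded)
    with assms show False by simp
  qed
  then obtain t w where tw: "\<And>k. 0 < t k" "\<And>k. t k < inverse (real (Suc k))"
      "\<And>k. dist (w k) u < inverse (real (Suc k))"
      "\<And>k. (\<psi> (x + t k *\<^sub>R w k) - \<psi> x) / ereal (t k) < c"
    by metis
  have "t \<longlonglongrightarrow> 0"
    using tw(1,2) by (intro tendsto_sandwich[OF _ _ tendsto_const LIMSEQ_inverse_real_of_nat])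
      (auto intro!: always_eventually less_imp_le)
  moreover have "(\<lambda>k. dist (w k) u) \<longlonglongrightarrow> 0"
    using tw(3) by (intro tendsto_sandwich[OF _ _ tendsto_const LIMSEQ_inverse_real_of_nat])
      (auto intro!: always_eventually less_imp_le)
  then have "w \<longlonglongrightarrow> u"
    by (rule tendsto_dist_iff[THEN iffD2])
  ultimately show thesis
    using tw that by blast
qed

theorem theorem3p8:
  fixes \<Omega> :: "'a::real_normed_vector set" and v x :: 'a
  assumes "\<Omega> \<noteq> {}" and "closed \<Omega>" and "v \<noteq> 0" and "x \<in> \<Omega>"
  shows "dini_hadamard_subdiff (minimal_time \<Omega> v) x =
           {f :: 'a \<Rightarrow>\<^sub>L real. blinfun_apply f (- v) \<le> 1} \<inter> dini_hadamard_normal_cone x \<Omega>"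
proof (intro equalityI subsetI)
  let ?T = "minimal_time \<Omega> v"
  have Tx: "?T x = 0"
    using \<open>x \<in> \<Omega>\<close> by (rule minimal_time_eq_0)
  fix f :: "'a \<Rightarrow>\<^sub>L real"
  assume "f \<in> dini_hadamard_subdiff ?T x"
  then have sub: "ereal (f h) \<le> dini_hadamard_deriv ?T x h" for h
    by (simp add: dini_hadamard_subdiff_def)
  have "dini_hadamard_deriv ?T x (- v) \<le> 1"
  proof (rule dini_hadamard_deriv_le[where t = "\<lambda>k. inverse (real (Suc k))" and w = "\<lambda>_. - v"])
    fix k
    let ?s = "inverse (real (Suc k))"
    \<comment> \<open>Moving along \<open>v\<close> for time \<open>?s\<close> leads from this point
      back to \<open>x\<close>, which lies in \<Omega>.\<close>
    have "?T (x + ?s *\<^sub>R (- v)) \<le> ereal ?s"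
      using \<open>x \<in> \<Omega>\<close> by (intro minimal_time_le) auto
    then show "(?T (x + ?s *\<^sub>R (- v)) - ?T x) / ereal ?s \<le> 1"
      unfolding Tx by (subst ereal_divide_le_pos) auto
  qed (use LIMSEQ_inverse_real_of_nat in auto)
  then have "f (- v) \<le> 1"
    using order_trans[OF sub] by (metis ereal_less_eq(3) one_ereal_def)
  moreover have "f d \<le> 0" if "d \<in> contingent_cone x \<Omega>" for d
  proof -
    from that obtain t e where "\<And>k. 0 < t k" "t \<longlonglongrightarrow> 0" "e \<longlonglongrightarrow> d"
        "\<And>k::nat. x + t k *\<^sub>R e k \<in> \<Omega>"
      unfolding contingent_cone_def by auto
    \<comment> \<open>The points \<open>x + t k *\<^sub>R e k\<close> lie in \<Omega>, where
      \<open>?T\<close> vanishes, so all these quotients are 0.\<close>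
    then have "dini_hadamard_deriv ?T x d \<le> 0"
      by (intro dini_hadamard_deriv_le[where t = t and w = e]) (auto simp: Tx minimal_time_eq_0)
    then show ?thesis
      using order_trans[OF sub] by (metis ereal_less_eq(3) zero_ereal_def)
  qed
  ultimately show "f \<in> {f. blinfun_apply f (- v) \<le> 1} \<inter> dini_hadamard_normal_cone x \<Omega>"
    by (simp add: dini_hadamard_normal_cone_def)
next
  let ?T = "minimal_time \<Omega> v"
  have Tx: "?T x = 0"
    using \<open>x \<in> \<Omega>\<close> by (rule minimal_time_eq_0)
  fix f :: "'a \<Rightarrow>\<^sub>L real"
  assume "f \<in> {f. blinfun_apply f (- v) \<le> 1} \<inter> dini_hadamard_normal_cone x \<Omega>"
  then have fv: "f (- v) \<le> 1" and normal: "\<And>d. d \<in> contingent_cone x \<Omega> \<Longrightarrow> f d \<le> 0"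
    by (auto simp: dini_hadamard_normal_cone_def)
  have "ereal (f h) \<le> dini_hadamard_deriv ?T x h" for h
  proof (rule ccontr)
    assume "\<not> ?thesis"
    \<comment> \<open>The gap is split by a real \<open>c\<close>: its upper side yields the
      sequences and bounds the hitting times, its lower side is contradicted at the end.\<close>
    then obtain c where c: "dini_hadamard_deriv ?T x h < ereal c" "c < f h"
      using ereal_dense2[of "dini_hadamard_deriv ?T x h" "ereal (f h)"] by (auto simp: not_le)
    obtain t w where t: "\<And>k. 0 < t k" "t \<longlonglongrightarrow> 0" and w: "w \<longlonglongrightarrow> h"
      and less: "\<And>k. (?T (x + t k *\<^sub>R w k) - ?T x) / ereal (t k) < ereal c"
      using dini_hadamard_deriv_lessD[OF c(1)] by blast
    \<comment> \<open>Here \<open>r\<close> is a hitting time \<open>s\<close> divided by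
      \<open>t k\<close>, which absorbs the motion along \<open>v\<close> into the direction
      \<open>w k\<close>.\<close>
    have "\<exists>r. 0 \<le> r \<and> r < c \<and> x + t k *\<^sub>R (w k + r *\<^sub>R v) \<in> \<Omega>" for k
    proof -
      have "?T (x + t k *\<^sub>R w k) < ereal (t k * c)"
        using less[of k] t(1)[of k] by (simp add: Tx ereal_divide_less_pos)
      then obtain s where s: "0 \<le> s" "s < t k * c" "x + t k *\<^sub>R w k + s *\<^sub>R v \<in> \<Omega>"
        by (rule minimal_time_lessD)
      have "x + t k *\<^sub>R (w k + (s / t k) *\<^sub>R v) = x + t k *\<^sub>R w k + s *\<^sub>R v"
        using t(1)[of k] by (simp add: scaleR_add_right)
      with s t(1)[of k] show ?thesis
        by (intro exI[of _ "s / t k"]) (simp add: field_simps)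
    qed
    then obtain r where r: "\<And>k. 0 \<le> r k" "\<And>k. r k < c"
        "\<And>k. x + t k *\<^sub>R (w k + r k *\<^sub>R v) \<in> \<Omega>"
      by metis
    \<comment> \<open>Compactness requires the closed interval. The limit may equal
      \<open>c\<close>, which is harmless because \<open>c < f h\<close> is strict.\<close>
    then have "\<forall>k. r k \<in> {0..c}"
      by (auto intro: less_imp_le)
    then obtain l \<sigma> where l: "l \<in> {0..c}" and \<sigma>: "strict_mono \<sigma>" and lim: "(r \<circ> \<sigma>) \<longlonglongrightarrow> l"
      using compact_Icc[of 0 c] unfolding compact_def by blast
    have "h + l *\<^sub>R v \<in> contingent_cone x \<Omega>"
      unfolding contingent_cone_def mem_Collect_eq
    proof (intro exI conjI allI)
      show "(t \<circ> \<sigma>) \<longlonglongrightarrow> 0"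
        using t(2) \<sigma> by (rule LIMSEQ_subseq_LIMSEQ)
      show "(\<lambda>k. (w \<circ> \<sigma>) k + (r \<circ> \<sigma>) k *\<^sub>R v) \<longlonglongrightarrow> h + l *\<^sub>R v"
        by (intro tendsto_intros lim LIMSEQ_subseq_LIMSEQ[OF w \<sigma>])
    qed (use t(1) r(3) in auto)
    then have "f h + l * f v \<le> 0"
      using normal[of "h + l *\<^sub>R v"] by (simp add: blinfun.add_right blinfun.scaleR_right)
    \<comment> \<open>With the previous bound and \<open>l\<close> in \<open>{0..c}\<close>, this
      gives \<open>f h \<le> l * f (- v) \<le> l \<le> c\<close>.\<close>
    moreover have "l * f (- v) \<le> l * 1"
      using fv l by (intro mult_left_mono) auto
    ultimately show False
      using c(2) l by (simp add: blinfun.minus_right)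
  qed
  then show "f \<in> dini_hadamard_subdiff ?T x"
    by (simp add: dini_hadamard_subdiff_def)
qed

end
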